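(* Let $\mathcal X\in\mathrm{Gr}(n,k)$ and let $0\le\theta_1\le\cdots\le\theta_k<\pi/2$ be the principal angles between $\mathcal X$ and $\mathcal V_\alpha$. Then $$2\,a(\mathcal X)\,(f(\mathcal X)-f^* )\le\langle\mathrm{grad}f(\mathcal X),-\mathrm{Log}_{\mathcal X}(\mathcal V_\alpha)\rangle,\qquad a(\mathcal X):=\frac{\theta_k}{\tan\theta_k}.$$
   Context: Let $1\le k\le n-1$ and let $A\in\mathbb R^{n\times n}$ be symmetric positive semidefinite with eigenvalues $\lambda_1\ge\cdots\ge\lambda_n$ (with multiplicity) and orthonormal eigenvectors $v_1,\dots,v_n$, $Av_i=\lambda_iv_i$. Put $\mathcal V_\alpha=\mathrm{span}(v_1,\dots,v_k)$ (if $\lambda_k=\lambda_{k+1}$, $\mathcal V_\alpha$ is any fixed subspace spanned by $k$ leading eigenvectors). Convention: $\frac{0}{\tan0}=1$. $\mathrm{Gr}(n,k)$ is the Grassmann manifold of $k$-dimensional subspaces of $\mathbb R^n$; a subspace $\mathcal X=\mathrm{span}(X)$ is always represented by $X\in\mathbb R^{n\times k}$ with $X^TX=I_k$. Tangent vectors at $\mathcal X$ (for a given representative $X$) are the $G\in\mathbb R^{n\times k}$ with $X^TG=0$; the Riemannian metric is $\langle G_1,G_2\rangle=\mathrm{Tr}(G_1^TG_2)$, both tangent vectors being taken with respect to the same $X$. The principal angles $0\le\theta_1\le\cdots\le\theta_k\le\pi/2$ between $\mathcal X=\mathrm{span}(X)$ and $\mathcal Y=\mathrm{span}(Y)$ are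 such that $\cos\theta_1,\dots,\cos\theta_k$ are the singular values of $Y^TX$. If all principal angles are $<\pi/2$, the Riemannian logarithm is $\mathrm{Log}_{\mathcal X}(\mathcal Y)=U\arctan(\widehat\Sigma)V^T$, where $U\widehat\Sigma V^T=(I-XX^T)Y(X^TY)^{-1}$ is a compact SVD. The objective is $f:\mathrm{Gr}(n,k)\to\mathbb R$, $f(\mathcal X)=-\mathrm{Tr}(X^TAX)$, with Riemannian gradient $\mathrm{grad}f(\mathcal X)=-2(I-XX^T)AX$ and global minimum $f^*=-(\lambda_1+\cdots+\lambda_k)$. *)

theory Defs
  imports "Jordan_Normal_Form.VS_Connect" "Jordan_Normal_Form.Gauss_Jordan_Elimination"
begin

text \<open>All families indexed by \<open>1, \<dots>, n\<close> on paper are indexed by \<open>0, \<dots>, n - 1\<close> here.\<close>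

definition mat_trace :: "'a::comm_monoid_add mat \<Rightarrow> 'a" where
  "mat_trace M = (\<Sum>i<dim_row M. M $$ (i, i))"

definition positive_semidefinite :: "nat \<Rightarrow> real mat \<Rightarrow> bool" where
  "positive_semidefinite n A \<longleftrightarrow>
     A \<in> carrier_mat n n \<and> transpose_mat A = A \<and>
     (\<forall>x \<in> carrier_vec n. 0 \<le> x \<bullet> (A *\<^sub>v x))"

text \<open>\<open>lam\<close> lists the eigenvalues of \<open>A\<close> with multiplicity, in decreasing order, and \<open>v\<close> an
  orthonormal basis of corresponding eigenvectors.\<close>

definition ordered_eigenbasis ::
    "nat \<Rightarrow> real mat \<Rightarrow> (nat \<Rightarrow> real) \<Rightarrow> (nat \<Rightarrow> real vec) \<Rightarrow> bool" where
  "ordered_eigenbasis n A lam v \<longleftrightarrow>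
     (\<forall>i<n. \<forall>j<n. i \<le> j \<longrightarrow> lam j \<le> lam i) \<and>
     (\<forall>i<n. v i \<in> carrier_vec n \<and> A *\<^sub>v v i = lam i \<cdot>\<^sub>v v i) \<and>
     (\<forall>i<n. \<forall>j<n. v i \<bullet> v j = (if i = j then 1 else 0))"

abbreviation vec_span :: "nat \<Rightarrow> real vec set \<Rightarrow> real vec set" where
  "vec_span n \<equiv> LinearCombinations.module.span class_ring (module_vec TYPE(real) n)"

definition grassmannian :: "nat \<Rightarrow> nat \<Rightarrow> real vec set set" where
  "grassmannian n k =
     {W. VectorSpace.subspace class_ring W (module_vec TYPE(real) n) \<and>
         vectorspace.dim class_ring ((module_vec TYPE(real) n)\<lparr>carrier := W\<rparr>) = k}"

definition stiefel :: "nat \<Rightarrow> nat \<Rightarrow> real mat set" where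
  "stiefel n k = {X \<in> carrier_mat n k. transpose_mat X * X = 1\<^sub>m k}"

definition represents :: "nat \<Rightarrow> nat \<Rightarrow> real mat \<Rightarrow> real vec set \<Rightarrow> bool" where
  "represents n k X W \<longleftrightarrow> X \<in> stiefel n k \<and> vec_span n (set (cols X)) = W"

definition tangent_space :: "nat \<Rightarrow> nat \<Rightarrow> real mat \<Rightarrow> real mat set" where
  "tangent_space n k X = {G \<in> carrier_mat n k. transpose_mat X * G = 0\<^sub>m k k}"

definition riem_metric :: "real mat \<Rightarrow> real mat \<Rightarrow> real" where
  "riem_metric G1 G2 = mat_trace (transpose_mat G1 * G2)"

definition singular_values :: "nat \<Rightarrow> real mat \<Rightarrow> (nat \<Rightarrow> real) \<Rightarrow> bool" where
  "singular_values k M s \<longleftrightarrow>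
     (\<forall>i<k. 0 \<le> s i) \<and>
     (\<exists>P \<in> stiefel k k. \<exists>Q \<in> stiefel k k. M = P * mat_diag k s * transpose_mat Q)"

text \<open>The angles depend only on the subspaces spanned by \<open>X\<close> and \<open>Y\<close>: another choice of
  orthonormal bases multiplies \<open>Y\<^sup>TX\<close> by orthogonal matrices on both sides.\<close>

definition principal_angles ::
    "nat \<Rightarrow> real mat \<Rightarrow> real mat \<Rightarrow> (nat \<Rightarrow> real) \<Rightarrow> bool" where
  "principal_angles k X Y th \<longleftrightarrow>
     (\<forall>i<k. 0 \<le> th i \<and> th i \<le> pi / 2) \<and>
     (\<forall>i<k. \<forall>j<k. i \<le> j \<longrightarrow> th i \<le> th j) \<and>
     singular_values k (transpose_mat Y * X) (\<lambda>i. cos (th i))"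

text \<open>The inner dimension \<open>r\<close> is forced to be the rank of \<open>M\<close>, and may be \<open>0\<close>.\<close>

definition compact_svd ::
    "nat \<Rightarrow> nat \<Rightarrow> real mat \<Rightarrow> nat \<Rightarrow> real mat \<Rightarrow> (nat \<Rightarrow> real) \<Rightarrow> real mat \<Rightarrow> bool" where
  "compact_svd n k M r U s V \<longleftrightarrow>
     U \<in> stiefel n r \<and> V \<in> stiefel k r \<and> (\<forall>i<r. 0 < s i) \<and>
     M = U * mat_diag r s * transpose_mat V"

text \<open>The Riemannian logarithm is meaningful when \<open>X\<^sup>TY\<close> is invertible, i.e. when all principal
  angles are below \<open>pi / 2\<close>. Its value does not depend on the chosen decomposition, nor on the
  representative \<open>Y\<close> of the second subspace.\<close>

definition riem_Log :: "nat \<Rightarrow> nat \<Rightarrow> real mat \<Rightarrow> real mat \<Rightarrow> real mat" where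
  "riem_Log n k X Y =
     (SOME L. \<exists>r U s V.
        compact_svd n k
          ((1\<^sub>m n - X * transpose_mat X) * Y * the (mat_inverse (transpose_mat X * Y))) r U s V \<and>
        L = U * mat_diag r (\<lambda>i. arctan (s i)) * transpose_mat V)"

definition objective :: "real mat \<Rightarrow> real mat \<Rightarrow> real" where
  "objective A X = - mat_trace (transpose_mat X * A * X)"

text \<open>Every point of the Grassmannian has an orthonormal representative, so ranging over
  \<^term>\<open>stiefel n k\<close> is ranging over the Grassmannian.\<close>

definition global_min :: "nat \<Rightarrow> nat \<Rightarrow> real mat \<Rightarrow> real" where
  "global_min n k A = (INF X \<in> stiefel n k. objective A X)"

definition riem_grad :: "nat \<Rightarrow> real mat \<Rightarrow> real mat \<Rightarrow> real mat" where
  "riem_grad n A X = (-2) \<cdot>\<^sub>m ((1\<^sub>m n - X * transpose_mat X) * A * X)"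

definition x_over_tan :: "real \<Rightarrow> real" where
  "x_over_tan t = (if t = 0 then 1 else t / tan t)"


lemma riem_grad_tangent:
  assumes X: "X \<in> stiefel n k" and A: "A \<in> carrier_mat n n"
  shows "riem_grad n A X \<in> tangent_space n k X"
proof -
  have Xc: "X \<in> carrier_mat n k" and XX: "transpose_mat X * X = 1\<^sub>m k"
    using X by (auto simp: stiefel_def)
  have Xt: "transpose_mat X \<in> carrier_mat k n" using Xc by simp
  have P: "X * transpose_mat X \<in> carrier_mat n n" using Xc by simp
  have "transpose_mat X * (1\<^sub>m n - X * transpose_mat X)
      = transpose_mat X - transpose_mat X * (X * transpose_mat X)"
    using Xt P by (simp add: mult_minus_distrib_mat[OF Xt one_carrier_mat P])
  also have "transpose_mat X * (X * transpose_mat X) = transpose_mat X"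
    using assoc_mult_mat[OF Xt Xc Xt] XX Xt by simp
  finally have Z: "transpose_mat X * (1\<^sub>m n - X * transpose_mat X) = 0\<^sub>m k n"
    using Xt by simp
  have Q: "1\<^sub>m n - X * transpose_mat X \<in> carrier_mat n n" using P by (rule minus_carrier_mat)
  have "transpose_mat X * ((1\<^sub>m n - X * transpose_mat X) * A * X) = 0\<^sub>m k k"
  proof -
    have AX: "A * X \<in> carrier_mat n k" using A Xc by simp
    have "transpose_mat X * ((1\<^sub>m n - X * transpose_mat X) * A * X)
        = transpose_mat X * ((1\<^sub>m n - X * transpose_mat X) * (A * X))"
      by (simp only: assoc_mult_mat[OF Q A Xc])
    also have "\<dots> = transpose_mat X * (1\<^sub>m n - X * transpose_mat X) * (A * X)"
      by (simp only: assoc_mult_mat[OF Xt Q AX])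
    also have "\<dots> = 0\<^sub>m k k"
      unfolding Z by (rule left_mult_zero_mat[OF AX])
    finally show ?thesis .
  qed
  moreover have "(1\<^sub>m n - X * transpose_mat X) * A * X \<in> carrier_mat n k"
    using Q A Xc by auto
  ultimately show ?thesis
    using Xt unfolding tangent_space_def riem_grad_def
    by (auto simp: mult_smult_distrib)
qed

lemma objective_sum:
  assumes "A \<in> carrier_mat n n" "X \<in> carrier_mat n k"
  shows "objective A X = - (\<Sum>j<k. \<Sum>i<n. \<Sum>l<n. X $$ (l, j) * A $$ (l, i) * X $$ (i, j))"
  using assms
proof -
  have "transpose_mat X * A * X = transpose_mat X * (A * X)"
    using assms by (intro assoc_mult_mat) auto
  then have "mat_trace (transpose_mat X * A * X)
      = (\<Sum>j<k. \<Sum>l<n. \<Sum>i<n. X $$ (l, j) * A $$ (l, i) * X $$ (i, j))"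
    using assms
    by (simp add: mat_trace_def scalar_prod_def sum_distrib_left atLeast0LessThan mult.assoc)
  also have "\<dots> = (\<Sum>j<k. \<Sum>i<n. \<Sum>l<n. X $$ (l, j) * A $$ (l, i) * X $$ (i, j))"
    by (intro sum.cong refl sum.swap)
  finally show ?thesis by (simp add: objective_def)
qed

lemma riem_metric_sum:
  assumes "G \<in> carrier_mat n k" "H \<in> carrier_mat n k"
  shows "riem_metric G H = (\<Sum>j<k. \<Sum>i<n. G $$ (i, j) * H $$ (i, j))"
  using assms
  by (simp add: riem_metric_def mat_trace_def scalar_prod_def atLeast0LessThan)

lemma riem_grad_metric:
  assumes X: "X \<in> stiefel n k" and A: "A \<in> carrier_mat n n" and H: "H \<in> tangent_space n k X"
  shows "riem_metric (riem_grad n A X) H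
       = - 2 * (\<Sum>j<k. \<Sum>i<n. (\<Sum>l<n. A $$ (i, l) * X $$ (l, j)) * H $$ (i, j))"
proof -
  have Xc: "X \<in> carrier_mat n k" using X by (auto simp: stiefel_def)
  have Hc: "H \<in> carrier_mat n k" and XH: "transpose_mat X * H = 0\<^sub>m k k"
    using H by (auto simp: tangent_space_def)
  have Xt: "transpose_mat X \<in> carrier_mat k n" using Xc by simp
  define B where "B = A * X"
  define C where "C = transpose_mat X * B"
  have B: "B \<in> carrier_mat n k" using A Xc by (simp add: B_def)
  have C: "C \<in> carrier_mat k k" using Xt B by (simp add: C_def)
  have P: "X * transpose_mat X \<in> carrier_mat n n" using Xc by simp
  have Q: "1\<^sub>m n - X * transpose_mat X \<in> carrier_mat n n" using P by (rule minus_carrier_mat)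
  have "(1\<^sub>m n - X * transpose_mat X) * A * X = (1\<^sub>m n - X * transpose_mat X) * B"
    unfolding B_def using assoc_mult_mat[OF Q A Xc] .
  also have "\<dots> = B - X * C"
    unfolding C_def using minus_mult_distrib_mat[OF one_carrier_mat P B]
      assoc_mult_mat[OF Xc Xt B] B by simp
  finally have g: "riem_grad n A X = (-2) \<cdot>\<^sub>m (B - X * C)"
    unfolding riem_grad_def by simp
  have gc: "riem_grad n A X \<in> carrier_mat n k" unfolding g using B Xc C by auto
  have g': "riem_grad n A X $$ (i, j) = -2 * B $$ (i, j) + 2 * (\<Sum>l<k. X $$ (i, l) * C $$ (l, j))"
    if "i < n" "j < k" for i j
    unfolding g using that B Xc C by (simp add: scalar_prod_def atLeast0LessThan)
  have XHs: "(\<Sum>i<n. X $$ (i, l) * H $$ (i, j)) = 0" if "l < k" "j < k" for l j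
  proof -
    have "(transpose_mat X * H) $$ (l, j) = 0" using XH that by simp
    then show ?thesis using that Xc Hc by (simp add: scalar_prod_def atLeast0LessThan)
  qed
  have "(\<Sum>i<n. riem_grad n A X $$ (i, j) * H $$ (i, j)) = -2 * (\<Sum>i<n. B $$ (i, j) * H $$ (i, j))"
    if j: "j < k" for j
  proof -
    have "(\<Sum>i<n. riem_grad n A X $$ (i, j) * H $$ (i, j))
        = (\<Sum>i<n. -2 * (B $$ (i, j) * H $$ (i, j))
            + (\<Sum>l<k. 2 * C $$ (l, j) * (X $$ (i, l) * H $$ (i, j))))"
    proof (intro sum.cong refl)
      fix i assume "i \<in> {..<n}"
      then have "riem_grad n A X $$ (i, j) = -2 * B $$ (i, j) + 2 * (\<Sum>l<k. X $$ (i, l) * C $$ (l, j))"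
        using g' j by simp
      then show "riem_grad n A X $$ (i, j) * H $$ (i, j) = -2 * (B $$ (i, j) * H $$ (i, j))
            + (\<Sum>l<k. 2 * C $$ (l, j) * (X $$ (i, l) * H $$ (i, j)))"
        by (simp add: left_diff_distrib right_diff_distrib distrib_left distrib_right
            sum_distrib_left sum_distrib_right mult_ac)
    qed
    also have "\<dots> = -2 * (\<Sum>i<n. B $$ (i, j) * H $$ (i, j))
        + (\<Sum>l<k. 2 * C $$ (l, j) * (\<Sum>i<n. X $$ (i, l) * H $$ (i, j)))"
      unfolding sum.distrib sum_distrib_left
      by (intro arg_cong2[where f = "(+)"] refl sum.swap)
    also have "(\<Sum>l<k. 2 * C $$ (l, j) * (\<Sum>i<n. X $$ (i, l) * H $$ (i, j))) = 0"
      using XHs j by simp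
    finally show ?thesis by simp
  qed
  then have "riem_metric (riem_grad n A X) H = (\<Sum>j<k. -2 * (\<Sum>i<n. B $$ (i, j) * H $$ (i, j)))"
    unfolding riem_metric_sum[OF gc Hc] by simp
  also have "\<dots> = -2 * (\<Sum>j<k. \<Sum>i<n. B $$ (i, j) * H $$ (i, j))"
    by (simp only: sum_distrib_left)
  also have "(\<Sum>j<k. \<Sum>i<n. B $$ (i, j) * H $$ (i, j))
     = (\<Sum>j<k. \<Sum>i<n. (\<Sum>l<n. A $$ (i, l) * X $$ (l, j)) * H $$ (i, j))"
    by (intro sum.cong refl)
       (use A Xc in \<open>simp add: B_def scalar_prod_def atLeast0LessThan\<close>)
  finally show ?thesis by simp
qed

text \<open>\<open>riem_grad\<close> is the Riemannian gradient: it is tangent, and it represents the derivative of the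
  objective along every curve of orthonormal representatives with tangent (horizontal) velocity.\<close>

lemma riem_grad_is_gradient:
  assumes A: "A \<in> carrier_mat n n" "transpose_mat A = A"
    and c: "\<And>t. c t \<in> stiefel n k" and X: "c 0 = X" and H: "H \<in> tangent_space n k X"
    and c': "\<And>i j. i < n \<Longrightarrow> j < k \<Longrightarrow>
               ((\<lambda>t. c t $$ (i, j)) has_real_derivative H $$ (i, j)) (at 0)"
  shows "((\<lambda>t. objective A (c t)) has_real_derivative riem_metric (riem_grad n A X) H) (at 0)"
proof -
  have cc: "c t \<in> carrier_mat n k" for t using c[of t] by (auto simp: stiefel_def)
  have Xs: "X \<in> stiefel n k" using c[of 0] X by simp
  have sym: "A $$ (i, l) = A $$ (l, i)" if "i < n" "l < n" for i l
    using arg_cong[OF A(2), of "\<lambda>M. M $$ (i, l)"] A(1) that by simp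
  have "((\<lambda>t. objective A (c t)) has_real_derivative
      - (\<Sum>j<k. \<Sum>i<n. \<Sum>l<n. H $$ (l, j) * A $$ (l, i) * X $$ (i, j)
           + X $$ (l, j) * A $$ (l, i) * H $$ (i, j))) (at 0)"
    unfolding objective_sum[OF A(1) cc]
    by (auto intro!: DERIV_minus DERIV_sum derivative_eq_intros c' simp: X algebra_simps)
  moreover have "(\<Sum>i<n. \<Sum>l<n. H $$ (l, j) * A $$ (l, i) * X $$ (i, j)
           + X $$ (l, j) * A $$ (l, i) * H $$ (i, j))
      = 2 * (\<Sum>i<n. (\<Sum>l<n. A $$ (i, l) * X $$ (l, j)) * H $$ (i, j))" for j
  proof -
    have "(\<Sum>i<n. \<Sum>l<n. H $$ (l, j) * A $$ (l, i) * X $$ (i, j))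
        = (\<Sum>i<n. (\<Sum>l<n. A $$ (i, l) * X $$ (l, j)) * H $$ (i, j))"
      by (subst sum.swap) (simp add: sum_distrib_right sum_distrib_left ac_simps)
    moreover have "(\<Sum>i<n. \<Sum>l<n. X $$ (l, j) * A $$ (l, i) * H $$ (i, j))
        = (\<Sum>i<n. (\<Sum>l<n. A $$ (i, l) * X $$ (l, j)) * H $$ (i, j))"
      by (auto simp: sum_distrib_right sym intro!: sum.cong)
    ultimately show ?thesis by (simp add: sum.distrib)
  qed
  ultimately have "((\<lambda>t. objective A (c t)) has_real_derivative
      - (\<Sum>j<k. 2 * (\<Sum>i<n. (\<Sum>l<n. A $$ (i, l) * X $$ (l, j)) * H $$ (i, j)))) (at 0)"
    by (simp only:)
  then show ?thesis
    unfolding riem_grad_metric[OF Xs A(1) H] by (simp only: mult_minus_left flip: sum_distrib_left)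
qed

lemma global_min_attained:
  assumes k: "1 \<le> k" "k \<le> n" and A: "A \<in> carrier_mat n n" and e: "ordered_eigenbasis n A lam v"
  shows "mat n k (\<lambda>(i, j). v j $ i) \<in> stiefel n k"
    and "objective A (mat n k (\<lambda>(i, j). v j $ i)) = - (\<Sum>i<k. lam i)"
    and "X \<in> stiefel n k \<Longrightarrow> - (\<Sum>i<k. lam i) \<le> objective A X"
    and "global_min n k A = - (\<Sum>i<k. lam i)"
proof -
  let ?V = "mat n k (\<lambda>(i, j). v j $ i)"
  have vc: "v i \<in> carrier_vec n" and Av: "A *\<^sub>v v i = lam i \<cdot>\<^sub>v v i" if "i < n" for i
    using e that by (auto simp: ordered_eigenbasis_def)
  have on: "(\<Sum>l<n. v i $ l * v j $ l) = (if i = j then 1 else 0)" if "i < n" "j < n" for i j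
  proof -
    have "v i \<bullet> v j = (if i = j then 1 else 0)"
      using e that unfolding ordered_eigenbasis_def by blast
    then show ?thesis using vc[OF that(1)] vc[OF that(2)] by (simp add: scalar_prod_def atLeast0LessThan)
  qed
  have Avs: "(\<Sum>m<n. A $$ (l, m) * v i $ m) = lam i * v i $ l" if "i < n" "l < n" for i l
    using arg_cong[OF Av[OF that(1)], of "\<lambda>w. w $ l"] that A vc[OF that(1)]
    by (simp add: scalar_prod_def atLeast0LessThan)
  show VS: "?V \<in> stiefel n k"
    using k on by (auto simp: stiefel_def scalar_prod_def atLeast0LessThan intro!: eq_matI)
  let ?W = "mat n n (\<lambda>(i, j). v j $ i)"
  have "transpose_mat ?W * ?W = 1\<^sub>m n"
    using on by (auto simp: scalar_prod_def atLeast0LessThan intro!: eq_matI)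
  then have WW: "?W * transpose_mat ?W = 1\<^sub>m n"
    by (intro mat_mult_left_right_inverse[of "transpose_mat ?W" n ?W]) auto
  have compl: "(\<Sum>m<n. v m $ a * v m $ b) = (if a = b then 1 else 0)" if "a < n" "b < n" for a b
    using arg_cong[OF WW, of "\<lambda>M. M $$ (a, b)"] that
    by (simp add: scalar_prod_def atLeast0LessThan)
  have quad: "objective A X = - (\<Sum>i<n. lam i * (\<Sum>j<k. (\<Sum>l<n. v i $ l * X $$ (l, j))\<^sup>2))"
    if X: "X \<in> carrier_mat n k" for X
  proof -
    have Adec: "A $$ (l, i) = (\<Sum>m<n. lam m * v m $ l * v m $ i)" if li: "l < n" "i < n" for l i
    proof -
      have "A $$ (l, i) = (\<Sum>b<n. A $$ (l, b) * (if b = i then 1 else 0))"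
        using li by (simp add: if_distrib[of "(*) _"] cong: if_cong)
      also have "\<dots> = (\<Sum>b<n. A $$ (l, b) * (\<Sum>m<n. v m $ b * v m $ i))"
        using li by (intro sum.cong refl) (simp add: compl)
      also have "\<dots> = (\<Sum>m<n. (\<Sum>b<n. A $$ (l, b) * v m $ b) * v m $ i)"
        unfolding sum_distrib_left sum_distrib_right
        by (subst sum.swap) (simp add: ac_simps)
      also have "\<dots> = (\<Sum>m<n. lam m * v m $ l * v m $ i)"
        using li by (intro sum.cong) (auto simp: Avs)
      finally show ?thesis .
    qed
    have "(\<Sum>i<n. \<Sum>l<n. X $$ (l, j) * A $$ (l, i) * X $$ (i, j))
        = (\<Sum>m<n. lam m * (\<Sum>l<n. v m $ l * X $$ (l, j))\<^sup>2)" for j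
    proof -
      have "(\<Sum>i<n. \<Sum>l<n. X $$ (l, j) * A $$ (l, i) * X $$ (i, j))
          = (\<Sum>i<n. \<Sum>l<n. \<Sum>m<n. lam m * ((v m $ l * X $$ (l, j)) * (v m $ i * X $$ (i, j))))"
        by (intro sum.cong refl)
           (auto simp: Adec sum_distrib_left sum_distrib_right ac_simps intro!: sum.cong)
      also have "\<dots> = (\<Sum>i<n. \<Sum>m<n. \<Sum>l<n. lam m * ((v m $ l * X $$ (l, j)) * (v m $ i * X $$ (i, j))))"
        by (intro sum.cong refl sum.swap)
      also have "\<dots> = (\<Sum>m<n. \<Sum>i<n. \<Sum>l<n. lam m * ((v m $ l * X $$ (l, j)) * (v m $ i * X $$ (i, j))))"
        by (rule sum.swap)
      also have "\<dots> = (\<Sum>m<n. lam m * (\<Sum>l<n. v m $ l * X $$ (l, j))\<^sup>2)"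
        by (simp add: power2_eq_square sum_distrib_left sum_distrib_right ac_simps)
      finally show ?thesis .
    qed
    then have "objective A X = - (\<Sum>j<k. \<Sum>m<n. lam m * (\<Sum>l<n. v m $ l * X $$ (l, j))\<^sup>2)"
      by (simp only: objective_sum[OF A X])
    also have "\<dots> = - (\<Sum>m<n. lam m * (\<Sum>j<k. (\<Sum>l<n. v m $ l * X $$ (l, j))\<^sup>2))"
      by (subst sum.swap) (simp only: sum_distrib_left)
    finally show ?thesis .
  qed
  show VO: "objective A ?V = - (\<Sum>i<k. lam i)"
  proof -
    have "(\<Sum>i<n. lam i * (\<Sum>j<k. (\<Sum>l<n. v i $ l * ?V $$ (l, j))\<^sup>2))
       = (\<Sum>i<n. lam i * (\<Sum>j<k. if i = j then 1 else 0))"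
      by (intro sum.cong refl arg_cong2[where f = "(*)"]) (use k on in auto)
    also have "\<dots> = (\<Sum>i<n. if i \<in> {..<k} then lam i else 0)"
      by (intro sum.cong) auto
    also have "\<dots> = (\<Sum>i<k. lam i)"
      by (subst sum.inter_restrict[symmetric]) (use k in \<open>auto intro!: sum.cong\<close>)
    finally show ?thesis by (simp add: quad)
  qed
  show lower: "- (\<Sum>i<k. lam i) \<le> objective A X" if "X \<in> stiefel n k" for X
  proof -
    have Xc: "X \<in> carrier_mat n k" and XX: "transpose_mat X * X = 1\<^sub>m k"
      using that by (auto simp: stiefel_def)
    define y where "y i j = (\<Sum>l<n. v i $ l * X $$ (l, j))" for i j
    define w where "w i = (\<Sum>j<k. (y i j)\<^sup>2)" for i
    have yy: "(\<Sum>i<n. y i a * y i b) = (if a = b then 1 else 0)" if ab: "a < k" "b < k" for a b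
    proof -
      have "(\<Sum>i<n. y i a * y i b)
          = (\<Sum>i<n. \<Sum>l<n. \<Sum>m<n. X $$ (l, a) * X $$ (m, b) * (v i $ l * v i $ m))"
        unfolding y_def sum_product by (simp add: ac_simps)
      also have "\<dots> = (\<Sum>l<n. \<Sum>i<n. \<Sum>m<n. X $$ (l, a) * X $$ (m, b) * (v i $ l * v i $ m))"
        by (rule sum.swap)
      also have "\<dots> = (\<Sum>l<n. \<Sum>m<n. \<Sum>i<n. X $$ (l, a) * X $$ (m, b) * (v i $ l * v i $ m))"
        by (intro sum.cong refl sum.swap)
      also have "\<dots> = (\<Sum>l<n. \<Sum>m<n. X $$ (l, a) * X $$ (m, b) * (if l = m then 1 else 0))"
        by (intro sum.cong refl) (simp add: compl flip: sum_distrib_left)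
      also have "\<dots> = (\<Sum>l<n. X $$ (l, a) * X $$ (l, b))"
        by (intro sum.cong refl) (simp add: if_distrib[of "(*) _"] cong: if_cong)
      also have "\<dots> = (if a = b then 1 else 0)"
        using arg_cong[OF XX, of "\<lambda>M. M $$ (a, b)"] ab Xc
        by (simp add: scalar_prod_def atLeast0LessThan)
      finally show ?thesis .
    qed
    have w0: "0 \<le> w i" for i unfolding w_def by (simp add: sum_nonneg)
    have w1: "w i \<le> 1" if i: "i < n" for i
    proof -
      have "(\<Sum>m<n. (\<Sum>j<k. y i j * y m j)\<^sup>2)
          = (\<Sum>m<n. \<Sum>a<k. \<Sum>b<k. y i a * y i b * (y m a * y m b))"
        unfolding power2_eq_square sum_product by (simp add: ac_simps)
      also have "\<dots> = (\<Sum>a<k. \<Sum>m<n. \<Sum>b<k. y i a * y i b * (y m a * y m b))"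
        by (rule sum.swap)
      also have "\<dots> = (\<Sum>a<k. \<Sum>b<k. \<Sum>m<n. y i a * y i b * (y m a * y m b))"
        by (intro sum.cong refl sum.swap)
      also have "\<dots> = (\<Sum>a<k. \<Sum>b<k. y i a * y i b * (if a = b then 1 else 0))"
        by (intro sum.cong refl) (simp add: yy flip: sum_distrib_left)
      also have "\<dots> = w i"
        unfolding w_def power2_eq_square
        by (intro sum.cong refl) (simp add: if_distrib[of "(*) _"] cong: if_cong)
      finally have *: "(\<Sum>m<n. (\<Sum>j<k. y i j * y m j)\<^sup>2) = w i" .
      have "(w i)\<^sup>2 = (\<Sum>j<k. y i j * y i j)\<^sup>2" by (simp add: w_def power2_eq_square)
      also have "\<dots> \<le> (\<Sum>m<n. (\<Sum>j<k. y i j * y m j)\<^sup>2)"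
        using i by (intro member_le_sum[of i "{..<n}" "\<lambda>m. (\<Sum>j<k. y i j * y m j)\<^sup>2"]) auto
      finally have "w i * w i \<le> w i" using * by (simp add: power2_eq_square)
      then show ?thesis using w0[of i]
        by (cases "w i = 0") (auto simp: mult_le_cancel_right1)
    qed
    have "(\<Sum>i<n. w i) = (\<Sum>j<k. \<Sum>i<n. y i j * y i j)"
      unfolding w_def power2_eq_square by (rule sum.swap)
    also have "\<dots> = real k" by (simp add: yy)
    finally have wk: "(\<Sum>i<n. w i) = real k" .
    have mono: "lam j \<le> lam i" if "i \<le> j" "j < n" for i j
      using e that unfolding ordered_eigenbasis_def by (meson le_less_trans)
    have "(\<Sum>i<n. (lam i - lam (k - 1)) * w i) \<le> (\<Sum>i<n. if i < k then lam i - lam (k - 1) else 0)"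
    proof (rule sum_mono)
      fix i assume "i \<in> {..<n}"
      then have i: "i < n" by simp
      show "(lam i - lam (k - 1)) * w i \<le> (if i < k then lam i - lam (k - 1) else 0)"
      proof (cases "i < k")
        case True
        then have "lam (k - 1) \<le> lam i" using k by (intro mono) auto
        then show ?thesis using True w1[OF i] by (simp add: mult_left_le)
      next
        case False
        then have "lam i \<le> lam (k - 1)" using i by (intro mono) auto
        then show ?thesis using False w0[of i] by (simp add: mult_nonpos_nonneg)
      qed
    qed
    also have "\<dots> = (\<Sum>i<k. lam i - lam (k - 1))"
    proof -
      have "{..<n} \<inter> {i. i < k} = {..<k}" using k by auto
      then show ?thesis by (simp add: sum.If_cases)
    qed
    finally have "(\<Sum>i<n. lam i * w i) - lam (k - 1) * (\<Sum>i<n. w i)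
        \<le> (\<Sum>i<k. lam i) - real k * lam (k - 1)"
      by (simp add: left_diff_distrib sum_subtractf sum_distrib_left)
    then have "(\<Sum>i<n. lam i * w i) \<le> (\<Sum>i<k. lam i)"
      unfolding wk by simp
    then show ?thesis
      by (simp add: quad[OF Xc] w_def y_def)
  qed
  show "global_min n k A = - (\<Sum>i<k. lam i)"
    unfolding global_min_def using VS VO lower
    by (intro cInf_eq_minimum) (force intro!: rev_image_eqI[of ?V])+
qed

end

theory Submission
  imports Defs
begin

text \<open>
  Rotate the two orthonormal bases so that they become principal vectors: the new columns
  \<open>x\<^sub>i\<close> of \<open>X Q\<close> and \<open>y\<^sub>i\<close> of \<open>Y P\<close> satisfy \<open>\<langle>y\<^sub>j, x\<^sub>i\<rangle> = 0\<close> for \<open>j \<noteq> i\<close> and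
  \<open>\<langle>y\<^sub>i, x\<^sub>i\<rangle> = c\<^sub>i = cos \<theta>\<^sub>i\<close>. The vectors \<open>n\<^sub>i = y\<^sub>i / c\<^sub>i - x\<^sub>i\<close> are then orthogonal to
  each other and to the first subspace and have length \<open>tan \<theta>\<^sub>i\<close>. They are the columns of
  \<open>(I - X X\<^sup>T) Y (X\<^sup>T Y)\<^sup>-\<^sup>1 Q\<close>, so the logarithm, rotated by \<open>Q\<close>, has the columns \<open>d\<^sub>i n\<^sub>i\<close>
  with \<open>d\<^sub>i = \<theta>\<^sub>i / tan \<theta>\<^sub>i\<close> (\<open>riem_Log_eq\<close>).

  Pairing with the gradient gives \<open>2 \<Sum> d\<^sub>i (\<langle>A x\<^sub>i, y\<^sub>i\<rangle> / c\<^sub>i - \<langle>A x\<^sub>i, x\<^sub>i\<rangle>)\<close>. The span of the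
  \<open>y\<^sub>j\<close> is invariant under \<open>A\<close>, and the projection of \<open>x\<^sub>i\<close> onto it is \<open>c\<^sub>i y\<^sub>i\<close>; hence
  \<open>\<langle>A x\<^sub>i, y\<^sub>i\<rangle> = c\<^sub>i \<langle>A y\<^sub>i, y\<^sub>i\<rangle>\<close> (\<open>rayleigh_mixed\<close>), and the pairing is \<open>2 \<Sum> d\<^sub>i g\<^sub>i\<close> with
  \<open>g\<^sub>i = \<langle>A y\<^sub>i, y\<^sub>i\<rangle> - \<langle>A x\<^sub>i, x\<^sub>i\<rangle>\<close>. By the invariance of the trace, the objective gap is the
  unweighted sum \<open>\<Sum> g\<^sub>i\<close> (\<open>leading_trace\<close>, \<open>objective_cols\<close>).

  It remains to compare the weights. Each \<open>g\<^sub>i\<close> is nonnegative, because passing from \<open>y\<^sub>i\<close> to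
  \<open>x\<^sub>i\<close> trades mass on leading eigenvectors for the same mass on later ones
  (\<open>rayleigh_le\<close>); and \<open>\<theta> / tan \<theta>\<close> decreases on \<open>[0, \<pi> / 2)\<close> (\<open>x_over_tan_antimono\<close>), so the
  smallest weight belongs to the largest angle.
\<close>

section \<open>The factor \<open>\<theta> / tan \<theta>\<close>\<close>

lemma x_over_tan_antimono:
  assumes s: "0 \<le> s" and st: "s \<le> t" and t: "t < pi / 2"
  shows "x_over_tan t \<le> x_over_tan s"
proof (cases "s = 0")
  case True
  \<comment> \<open>At \<open>0\<close> the function takes its limit \<open>1\<close>, so the claim there is \<open>t \<le> tan t\<close>.\<close>
  have "t \<le> tan t"
  proof -
    have "tan 0 - 0 \<le> tan t - t"
    proof (rule DERIV_nonneg_imp_nondecreasing[of 0 t "\<lambda>x. tan x - x"])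
      show "0 \<le> t" using st True by simp
      fix x :: real assume x: "0 \<le> x" "x \<le> t"
      have c: "0 < cos x" using x t by (intro cos_gt_zero_pi) auto
      have "((\<lambda>x. tan x - x) has_real_derivative inverse ((cos x)\<^sup>2) - 1) (at x)"
        using c by (auto intro!: derivative_eq_intros)
      moreover have "1 \<le> inverse ((cos x)\<^sup>2)"
        using c by (intro one_le_inverse) (auto simp: power_le_one)
      ultimately show "\<exists>y. ((\<lambda>x. tan x - x) has_real_derivative y) (at x) \<and> 0 \<le> y"
        by (intro exI conjI) auto
    qed
    then show ?thesis by simp
  qed
  then show ?thesis
    using True st t tan_gt_zero[of t] by (auto simp: x_over_tan_def)
next
  case False
  \<comment> \<open>Away from \<open>0\<close>, the derivative of \<open>x cos x / sin x\<close> has the sign of \<open>sin x cos x - x\<close>.\<close>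
  let ?g = "\<lambda>x. x * cos x / sin x"
  have pos: "0 < s" using False s by simp
  have "?g t \<le> ?g s"
  proof (rule DERIV_nonpos_imp_nonincreasing[OF st])
    fix x assume x: "s \<le> x" "x \<le> t"
    have sx: "0 < sin x" using x pos t by (intro sin_gt_zero) auto
    have "(?g has_real_derivative (sin x * cos x - x) / (sin x)\<^sup>2) (at x)"
    proof -
      have "(?g has_real_derivative
          ((1 * cos x + x * (- sin x)) * sin x - x * cos x * cos x) / (sin x * sin x)) (at x)"
        using sx by (auto intro!: derivative_eq_intros)
      moreover have "(1 * c + x * (- s)) * s - x * c * c = s * c - x * (s\<^sup>2 + c\<^sup>2)" for s c :: real
        by (simp add: algebra_simps power2_eq_square)
      then have "(1 * cos x + x * (- sin x)) * sin x - x * cos x * cos x = sin x * cos x - x"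
        by simp
      ultimately show ?thesis by (simp only: power2_eq_square)
    qed
    moreover have "sin x * cos x \<le> x"
    proof -
      have "sin x * cos x \<le> sin x" using sx by (simp add: mult_left_le)
      also have "\<dots> \<le> x" using x pos by (intro sin_x_le_x) auto
      finally show ?thesis .
    qed
    ultimately show "\<exists>y. (?g has_real_derivative y) (at x) \<and> y \<le> 0"
      by (auto simp: divide_nonpos_nonneg)
  qed
  moreover have "x_over_tan x = ?g x" if "0 < x" for x
    using that by (simp add: x_over_tan_def tan_def)
  ultimately show ?thesis using pos st by simp
qed

section \<open>Matrices with orthonormal columns\<close>

lemma col_scalar_prod_mat:
  assumes "M \<in> carrier_mat n k" "N \<in> carrier_mat n l" "i < k" "j < l"
  shows "(transpose_mat M * N) $$ (i, j) = col M i \<bullet> col N j"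
  using assms by simp

lemma stiefelD:
  assumes "X \<in> stiefel n k"
  shows "X \<in> carrier_mat n k" "transpose_mat X \<in> carrier_mat k n" "transpose_mat X * X = 1\<^sub>m k"
  using assms by (auto simp: stiefel_def)

lemma stiefel_square:
  assumes "Q \<in> stiefel k k"
  shows "Q * transpose_mat Q = 1\<^sub>m k"
  using mat_mult_left_right_inverse[of "transpose_mat Q" k Q] stiefelD[OF assms] by simp

lemma gram_mult_right:
  fixes Y X P Q :: "real mat"
  assumes "Y \<in> carrier_mat n k" "X \<in> carrier_mat n k" "P \<in> carrier_mat k l" "Q \<in> carrier_mat k l"
  shows "transpose_mat (Y * P) * (X * Q) = transpose_mat P * (transpose_mat Y * X) * Q"
proof -
  have "transpose_mat (Y * P) * (X * Q) = transpose_mat P * transpose_mat Y * (X * Q)"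
    using assms by (simp add: transpose_mult)
  also have "\<dots> = transpose_mat P * (transpose_mat Y * (X * Q))"
    using assms by (intro assoc_mult_mat[of _ l k _ n _ l]) auto
  also have "transpose_mat Y * (X * Q) = transpose_mat Y * X * Q"
    using assms by (intro assoc_mult_mat[symmetric, of _ k n _ k _ l]) auto
  also have "transpose_mat P * (transpose_mat Y * X * Q) = transpose_mat P * (transpose_mat Y * X) * Q"
    using assms by (intro assoc_mult_mat[symmetric, of _ l k _ k _ l]) auto
  finally show ?thesis .
qed

lemma stiefel_mult_right:
  assumes X: "X \<in> stiefel n k" and Q: "Q \<in> stiefel k l"
  shows "X * Q \<in> stiefel n l"
  using gram_mult_right[of X n k X Q l Q] stiefelD[OF X] stiefelD[OF Q]
  by (auto simp: stiefel_def)

lemma mult_stiefel_cancel: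
  assumes Q: "Q \<in> stiefel k k" and M: "M \<in> carrier_mat n k"
  shows "M * Q * transpose_mat Q = M" "M * transpose_mat Q * Q = M"
proof -
  have "M * Q * transpose_mat Q = M * (Q * transpose_mat Q)"
    using stiefelD[OF Q] M by (intro assoc_mult_mat) auto
  then show "M * Q * transpose_mat Q = M" using stiefel_square[OF Q] M by simp
  have "M * transpose_mat Q * Q = M * (transpose_mat Q * Q)"
    using stiefelD[OF Q] M by (intro assoc_mult_mat) auto
  then show "M * transpose_mat Q * Q = M" using stiefelD[OF Q] M by simp
qed

lemma mat_trace_mult_comm:
  fixes M N :: "real mat"
  assumes "M \<in> carrier_mat n k" "N \<in> carrier_mat k n"
  shows "mat_trace (M * N) = mat_trace (N * M)"
proof -
  have "mat_trace (M * N) = (\<Sum>i<n. \<Sum>j<k. M $$ (i, j) * N $$ (j, i))"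
    using assms by (simp add: mat_trace_def scalar_prod_def atLeast0LessThan)
  also have "\<dots> = (\<Sum>j<k. \<Sum>i<n. M $$ (i, j) * N $$ (j, i))" by (rule sum.swap)
  also have "\<dots> = mat_trace (N * M)"
    using assms by (simp add: mat_trace_def scalar_prod_def atLeast0LessThan mult.commute)
  finally show ?thesis .
qed

lemma mult_uminus_right_mat:
  fixes M :: "'a::ring mat"
  assumes "M \<in> carrier_mat n k" "N \<in> carrier_mat k l"
  shows "M * (- N) = - (M * N)"
  using assms by (auto simp: scalar_prod_def sum_negf intro!: eq_matI)

lemma mat_diag_transpose: "transpose_mat (mat_diag n f) = mat_diag n f"
  by (auto simp: mat_diag_def)

section \<open>Spectral functions of a singular value decomposition\<close>

text \<open>In \<open>N Q\<^sup>T\<close> with orthogonal columns of \<open>N\<close> and orthogonal \<open>Q\<close>, a compact decomposition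
  can be read off: normalise the nonzero columns of \<open>N\<close>, drop the zero ones, and keep the
  corresponding columns of \<open>Q\<close>. This makes the choice in the definition of the logarithm
  a choice from a nonempty set.\<close>

lemma compact_svd_exists:
  assumes N: "N \<in> carrier_mat n k" and Q: "Q \<in> stiefel k k"
    and gram: "transpose_mat N * N = mat_diag k (\<lambda>i. (t i)\<^sup>2)" and t: "\<And>i. i < k \<Longrightarrow> 0 \<le> t i"
  shows "\<exists>r U s V. compact_svd n k (N * transpose_mat Q) r U s V"
proof -
  \<comment> \<open>\<open>e\<close> enumerates the indices of the nonzero columns.\<close>
  define S where "S = {i. i < k \<and> t i \<noteq> 0}"
  have finS: "finite S" by (simp add: S_def)
  obtain e where e: "bij_betw e {0..<card S} S"
    using ex_bij_betw_nat_finite[OF finS] by blast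
  define r where "r = card S"
  have e: "bij_betw e {..<r} S" using e by (simp add: r_def atLeast0LessThan)
  have eS: "e a < k" "t (e a) \<noteq> 0" "0 < t (e a)" if "a < r" for a
    using bij_betwE[OF e] that t[of "e a"] by (force simp: S_def less_le)+
  have einj: "e a = e b \<longleftrightarrow> a = b" if "a < r" "b < r" for a b
    using e that by (auto simp: bij_betw_def inj_on_def)
  have g: "(\<Sum>l<n. N $$ (l, i) * N $$ (l, j)) = (if i = j then (t i)\<^sup>2 else 0)" if "i < k" "j < k" for i j
    using arg_cong[OF gram, of "\<lambda>M. M $$ (i, j)"] that N
    by (auto simp: scalar_prod_def atLeast0LessThan mat_diag_def)
  have q: "(\<Sum>l<k. Q $$ (l, i) * Q $$ (l, j)) = (if i = j then 1 else 0)" if "i < k" "j < k" for i j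
    using arg_cong[OF stiefelD(3)[OF Q], of "\<lambda>M. M $$ (i, j)"] that stiefelD(1)[OF Q]
    by (auto simp: scalar_prod_def atLeast0LessThan)
  define U where "U = mat n r (\<lambda>(l, a). N $$ (l, e a) / t (e a))"
  define V where "V = mat k r (\<lambda>(l, a). Q $$ (l, e a))"
  have "U \<in> stiefel n r"
    using eS einj by (auto simp: stiefel_def U_def scalar_prod_def atLeast0LessThan g power2_eq_square
        simp flip: sum_divide_distrib intro!: eq_matI)
  moreover have "V \<in> stiefel k r"
    using eS einj by (auto simp: stiefel_def V_def scalar_prod_def atLeast0LessThan q intro!: eq_matI)
  moreover have "N * transpose_mat Q = U * mat_diag r (\<lambda>a. t (e a)) * transpose_mat V"
  proof -
    have N0: "N $$ (l, i) = 0" if "l < n" "i < k" "t i = 0" for l i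
    proof -
      have "(\<Sum>l<n. (N $$ (l, i))\<^sup>2) = 0" using g[of i i] that by (simp add: power2_eq_square)
      then show ?thesis using that by (simp add: sum_nonneg_eq_0_iff)
    qed
    have "U * mat_diag r (\<lambda>a. t (e a)) = mat n r (\<lambda>(l, a). N $$ (l, e a))"
      by (subst mat_diag_mult_right[of _ n]) (use eS in \<open>auto simp: U_def intro!: eq_matI\<close>)
    moreover have "(\<Sum>i<k. N $$ (l, i) * Q $$ (m, i)) = (\<Sum>a<r. N $$ (l, e a) * Q $$ (m, e a))"
      if "l < n" for l m
    proof -
      have "(\<Sum>i<k. N $$ (l, i) * Q $$ (m, i)) = (\<Sum>i\<in>S. N $$ (l, i) * Q $$ (m, i))"
        using N0 that by (intro sum.mono_neutral_right) (auto simp: S_def)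
      also have "\<dots> = (\<Sum>a<r. N $$ (l, e a) * Q $$ (m, e a))"
        by (rule sum.reindex_bij_betw[OF e, symmetric])
      finally show ?thesis .
    qed
    ultimately show ?thesis using N stiefelD[OF Q]
      by (auto simp: scalar_prod_def atLeast0LessThan V_def intro!: eq_matI)
  qed
  ultimately have "compact_svd n k (N * transpose_mat Q) r U (\<lambda>a. t (e a)) V"
    using eS by (auto simp: compact_svd_def)
  then show ?thesis by blast
qed

text \<open>Applying a scalar function to the singular values gives the same matrix for every compact
  decomposition, which is what makes the logarithm well defined. If \<open>W = V\<^sup>T Q\<close> is the change
  between two systems of right singular vectors, the two diagonalisations of \<open>M\<^sup>T M\<close> force
  \<open>(s\<^sub>a\<^sup>2 - t\<^sub>i\<^sup>2) W\<^sub>a\<^sub>i = 0\<close>, so \<open>W\<close> only links equal singular values, and \<open>\<phi>\<close> passes through it.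
  The values of \<open>\<phi>\<close> enter through the quotients \<open>h\<^sub>i = \<phi> (t\<^sub>i) / t\<^sub>i\<close>; where \<open>t\<^sub>i = 0\<close>, the column
  of \<open>N\<close> vanishes and \<open>h\<^sub>i\<close> is arbitrary.\<close>

lemma compact_svd_fun_unique:
  assumes svd: "compact_svd n k (N * transpose_mat Q) r U s V"
    and N: "N \<in> carrier_mat n k" and Q: "Q \<in> stiefel k k"
    and gram: "transpose_mat N * N = mat_diag k (\<lambda>i. (t i)\<^sup>2)" and t: "\<And>i. i < k \<Longrightarrow> 0 \<le> t i"
    and h: "\<And>i. i < k \<Longrightarrow> h i * t i = \<phi> (t i)"
  shows "U * mat_diag r (\<lambda>a. \<phi> (s a)) * transpose_mat V = N * mat_diag k h * transpose_mat Q"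
proof -
  let ?S = "mat_diag r s"
  define W where "W = transpose_mat V * Q"
  note Qc = stiefelD[OF Q]
  have U: "U \<in> stiefel n r" and V: "V \<in> stiefel k r" and s: "\<And>a. a < r \<Longrightarrow> 0 < s a"
    and M: "N * transpose_mat Q = U * ?S * transpose_mat V"
    using svd by (auto simp: compact_svd_def)
  note Uc = stiefelD[OF U] and Vc = stiefelD[OF V]
  have W: "W \<in> carrier_mat r k" using Vc Qc by (simp add: W_def)
  have cols: "U * D * transpose_mat V * Q = U * (D * W)" if "D \<in> carrier_mat r r" for D
  proof -
    have "U * D * transpose_mat V * Q = U * D * W"
      unfolding W_def using that Uc Vc Qc by (intro assoc_mult_mat[of _ n r _ k _ k]) auto
    also have "\<dots> = U * (D * W)" using that Uc W by (intro assoc_mult_mat) auto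
    finally show ?thesis .
  qed
  have NU: "N = U * (?S * W)"
    using mult_stiefel_cancel(2)[OF Q N] cols[of ?S] M by simp
  have SW: "?S * W \<in> carrier_mat r k" using W by (meson mat_diag_dim mult_carrier_mat)
  have UN: "transpose_mat U * N = ?S * W"
  proof -
    have "transpose_mat U * N = transpose_mat U * U * (?S * W)"
      unfolding NU using Uc SW by (intro assoc_mult_mat[symmetric]) auto
    then show ?thesis using Uc left_mult_one_mat[OF SW] by simp
  qed
  have VQ: "V = Q * transpose_mat W"
  proof -
    have "Q * transpose_mat W = Q * (transpose_mat Q * V)"
      using Vc Qc by (simp add: W_def transpose_mult[of _ r k])
    also have "\<dots> = Q * transpose_mat Q * V"
      using Vc Qc by (intro assoc_mult_mat[symmetric]) auto
    finally show ?thesis using stiefel_square[OF Q] Vc by simp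
  qed
  \<comment> \<open>Both sides are \<open>V\<^sup>T (M\<^sup>T M) Q\<close> for the decomposed matrix \<open>M\<close>.\<close>
  have intertwine: "(s a)\<^sup>2 * W $$ (a, i) = W $$ (a, i) * (t i)\<^sup>2" if ai: "a < r" "i < k" for a i
  proof -
    have "N * transpose_mat W = U * ?S"
    proof -
      have "N * transpose_mat W = N * transpose_mat Q * Q * transpose_mat W"
        using mult_stiefel_cancel(2)[OF Q N] by simp
      also have "\<dots> = N * transpose_mat Q * (Q * transpose_mat W)"
        using N Qc W by (intro assoc_mult_mat[of _ n k _ k _ r]) auto
      also have "\<dots> = U * ?S * transpose_mat V * V" by (simp add: M flip: VQ)
      also have "\<dots> = U * ?S * (transpose_mat V * V)"
        using Uc Vc by (intro assoc_mult_mat[of _ n r _ k _ r]) auto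
      also have "\<dots> = U * ?S"
        using Uc Vc by (simp add: right_mult_one_mat[of _ n r] mult_carrier_mat[of _ n r])
      finally show ?thesis .
    qed
    then have "transpose_mat (N * transpose_mat W) * N = transpose_mat (U * ?S) * N" by simp
    then have "W * (transpose_mat N * N) = ?S * (transpose_mat U * N)"
    proof -
      have "transpose_mat (N * transpose_mat W) * N = W * (transpose_mat N * N)"
        using N W by (simp add: transpose_mult[of _ n k _ r] assoc_mult_mat[of _ r k _ n _ k])
      moreover have "transpose_mat (U * ?S) * N = ?S * (transpose_mat U * N)"
        using N Uc by (simp add: transpose_mult[of _ n r _ r] mat_diag_transpose
            assoc_mult_mat[of _ r r _ n _ k])
      ultimately show ?thesis
        using \<open>transpose_mat (N * transpose_mat W) * N = transpose_mat (U * ?S) * N\<close> by simp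
    qed
    then have "W * mat_diag k (\<lambda>i. (t i)\<^sup>2) = mat_diag r (\<lambda>a. s a * s a) * W"
      using W by (simp add: gram UN flip: assoc_mult_mat[of _ r r _ r _ k])
    then have "(W * mat_diag k (\<lambda>i. (t i)\<^sup>2)) $$ (a, i) = (mat_diag r (\<lambda>a. s a * s a) * W) $$ (a, i)"
      by simp
    then have "W $$ (a, i) * (t i)\<^sup>2 = s a * s a * W $$ (a, i)"
      using W ai by (simp add: mat_diag_mult_left[of _ r k] mat_diag_mult_right[of _ r k]
          del: mult_eq_0_iff mult_cancel_left mult_cancel_right)
    then show ?thesis by (simp only: power2_eq_square)
  qed
  have "mat_diag r (\<lambda>a. \<phi> (s a)) * W = ?S * W * mat_diag k h"
  proof -
    have "\<phi> (s a) * W $$ (a, i) = s a * W $$ (a, i) * h i" if "a < r" "i < k" for a i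
    proof (cases "W $$ (a, i) = 0")
      case False
      then have "s a = t i"
        using intertwine[OF that] s[OF that(1)] t[OF that(2)] by (auto simp: power2_eq_iff)
      then show ?thesis using h[OF that(2)] by (simp add: mult_ac)
    qed simp
    then show ?thesis using W
      by (auto simp: mat_diag_mult_left[of _ r k] mat_diag_mult_right[of _ r k]
          simp del: mult_eq_0_iff mult_cancel_left mult_cancel_right intro!: eq_matI)
  qed
  then have "U * (mat_diag r (\<lambda>a. \<phi> (s a)) * W) = U * (?S * W) * mat_diag k h"
    using Uc SW by (simp add: assoc_mult_mat[of _ n r _ k _ k])
  then have "U * mat_diag r (\<lambda>a. \<phi> (s a)) * transpose_mat V * Q = N * mat_diag k h"
    by (simp add: cols flip: NU)
  then show ?thesis
    using mult_stiefel_cancel(1)[OF Q, of "U * mat_diag r (\<lambda>a. \<phi> (s a)) * transpose_mat V" n] Uc Vc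
    by (metis mat_diag_dim mult_carrier_mat)
qed


section \<open>Principal vectors and the Riemannian logarithm\<close>

lemma principal_vectors:
  assumes X: "X \<in> stiefel n k" and Y: "Y \<in> stiefel n k" and th: "principal_angles k X Y th"
  obtains P Q where "P \<in> stiefel k k" "Q \<in> stiefel k k"
    "transpose_mat (Y * P) * (X * Q) = mat_diag k (\<lambda>i. cos (th i))"
proof -
  obtain P Q where P: "P \<in> stiefel k k" and Q: "Q \<in> stiefel k k"
    and YX: "transpose_mat Y * X = P * mat_diag k (\<lambda>i. cos (th i)) * transpose_mat Q"
    using th by (auto simp: principal_angles_def singular_values_def)
  let ?C = "mat_diag k (\<lambda>i. cos (th i))"
  note Pc = stiefelD[OF P] and Qc = stiefelD[OF Q]
  have "transpose_mat (Y * P) * (X * Q) = transpose_mat P * (P * ?C * transpose_mat Q) * Q"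
    using gram_mult_right[of Y n k X P k Q] stiefelD[OF X] stiefelD[OF Y] Pc Qc YX by simp
  also have "\<dots> = transpose_mat P * (P * ?C * transpose_mat Q * Q)"
    using Pc Qc by (intro assoc_mult_mat[of _ k k _ k _ k]) auto
  also have "P * ?C * transpose_mat Q * Q = P * ?C"
    using mult_stiefel_cancel(2)[OF Q, of "P * ?C" k] Pc by (meson mat_diag_dim mult_carrier_mat)
  also have "transpose_mat P * (P * ?C) = transpose_mat P * P * ?C"
    using Pc by (intro assoc_mult_mat[symmetric, of _ k k _ k _ k]) auto
  finally have "transpose_mat (Y * P) * (X * Q) = ?C"
    using Pc left_mult_one_mat[OF mat_diag_dim] by simp
  then show ?thesis using that P Q by blast
qed

lemma the_mat_inverse_eqI:
  fixes G :: "'a::field mat"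
  assumes G: "G \<in> carrier_mat k k" and B: "B \<in> carrier_mat k k" and GB: "G * B = 1\<^sub>m k"
  shows "the (mat_inverse G) = B"
proof (cases "mat_inverse G")
  case None
  have "B * G = 1\<^sub>m k" by (rule mat_mult_left_right_inverse[OF G B GB])
  then have "G \<in> Units (ring_mat TYPE('a) k undefined)"
    using G B GB by (auto simp: Units_def ring_mat_def)
  then show ?thesis using mat_inverse(1)[OF G None, of undefined] by blast
next
  case (Some B')
  then have B': "B' * G = 1\<^sub>m k" "B' \<in> carrier_mat k k"
    using mat_inverse(2)[OF G] by blast+
  have "B' = B' * (G * B)" using B' GB by simp
  also have "\<dots> = B' * G * B" by (rule assoc_mult_mat[OF B'(2) G B, symmetric])
  also have "\<dots> = B" using B' B by simp
  finally show ?thesis using Some by simp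
qed

text \<open>When the columns of \<open>X\<close> and \<open>Y\<close> are paired principal vectors, column \<open>i\<close> points from \<open>x\<^sub>i\<close>
  to the multiple of \<open>y\<^sub>i\<close> that projects onto \<open>x\<^sub>i\<close>: it is \<open>tan \<theta>\<^sub>i\<close> times the unit initial
  velocity of the rotation of \<open>x\<^sub>i\<close> towards \<open>y\<^sub>i\<close>, or zero if the two coincide.\<close>

definition secant_mat :: "nat \<Rightarrow> real mat \<Rightarrow> real mat \<Rightarrow> (nat \<Rightarrow> real) \<Rightarrow> real mat" where
  "secant_mat k X Y th = Y * mat_diag k (\<lambda>i. 1 / cos (th i)) - X"

lemma col_secant_mat:
  assumes X: "X \<in> carrier_mat n k" and Y: "Y \<in> carrier_mat n k" and i: "i < k"
  shows "col (secant_mat k X Y th * mat_diag k d) i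
       = d i \<cdot>\<^sub>v ((1 / cos (th i)) \<cdot>\<^sub>v col Y i - col X i)"
proof -
  have "secant_mat k X Y th \<in> carrier_mat n k"
    using X by (auto simp: secant_mat_def intro: minus_carrier_mat)
  then show ?thesis
    using X Y i by (auto simp: mat_diag_mult_right[of _ n k] secant_mat_def intro!: eq_vecI)
qed

context
  fixes n k :: nat and X Y P Q :: "real mat" and th :: "nat \<Rightarrow> real"
  assumes X: "X \<in> stiefel n k" and Y: "Y \<in> stiefel n k"
    and P: "P \<in> stiefel k k" and Q: "Q \<in> stiefel k k"
    and th: "\<And>i. i < k \<Longrightarrow> 0 \<le> th i \<and> th i < pi / 2"
    and gram: "transpose_mat (Y * P) * (X * Q) = mat_diag k (\<lambda>i. cos (th i))"
begin

private abbreviation "C \<equiv> mat_diag k (\<lambda>i. cos (th i))"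
private abbreviation "D \<equiv> mat_diag k (\<lambda>i. 1 / cos (th i))"
private abbreviation "N \<equiv> secant_mat k (X * Q) (Y * P) th"

private lemmas Xc = stiefelD[OF X] and Yc = stiefelD[OF Y] and Pc = stiefelD[OF P] and Qc = stiefelD[OF Q]
private lemmas XQ = stiefelD[OF stiefel_mult_right[OF X Q]] and YP = stiefelD[OF stiefel_mult_right[OF Y P]]

private lemma cos_pos: "i < k \<Longrightarrow> 0 < cos (th i)"
  using th[of i] by (intro cos_gt_zero_pi) auto

private lemma cos_diag_inverse: "C * D = 1\<^sub>m k" "D * C = 1\<^sub>m k"
  unfolding mat_diag_diag using cos_pos by (auto simp: mat_diag_def less_le intro!: eq_matI)

private lemma gram_flipped: "transpose_mat (X * Q) * (Y * P) = C"
proof -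
  have "transpose_mat (transpose_mat (Y * P) * (X * Q)) = transpose_mat (X * Q) * (Y * P)"
    using XQ YP by (simp add: transpose_mult[of _ k n _ k])
  then show ?thesis by (simp add: gram mat_diag_transpose)
qed

private lemma scaled_carrier: "Y * P * D \<in> carrier_mat n k"
  using YP by (meson mat_diag_dim mult_carrier_mat)

lemma secant_carrier: "N \<in> carrier_mat n k"
  using XQ by (auto simp: secant_mat_def intro: minus_carrier_mat)

private lemma scaled_cross_gram: "transpose_mat (X * Q) * (Y * P * D) = 1\<^sub>m k"
proof -
  have "transpose_mat (X * Q) * (Y * P * D) = transpose_mat (X * Q) * (Y * P) * D"
    using XQ YP by (intro assoc_mult_mat[symmetric, of _ k n _ k _ k]) auto
  then show ?thesis by (simp only: gram_flipped cos_diag_inverse)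
qed

lemma secant_tangent: "transpose_mat (X * Q) * N = 0\<^sub>m k k"
  unfolding secant_mat_def
  using mult_minus_distrib_mat[OF XQ(2) scaled_carrier XQ(1)] scaled_cross_gram XQ(3) by simp

lemma secant_gram: "transpose_mat N * N = mat_diag k (\<lambda>i. (tan (th i))\<^sup>2)"
proof -
  have ED: "transpose_mat (Y * P * D) = D * transpose_mat (Y * P)"
    using YP by (simp add: transpose_mult[of _ n k _ k] mat_diag_transpose)
  have Et: "transpose_mat (Y * P * D) \<in> carrier_mat k n" using scaled_carrier by simp
  have "transpose_mat (Y * P * D) * (Y * P * D) = D * (transpose_mat (Y * P) * (Y * P * D))"
    unfolding ED using YP scaled_carrier by (intro assoc_mult_mat[of _ k k _ n _ k]) auto
  also have "transpose_mat (Y * P) * (Y * P * D) = transpose_mat (Y * P) * (Y * P) * D"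
    using YP by (intro assoc_mult_mat[symmetric, of _ k n _ k _ k]) auto
  finally have EE: "transpose_mat (Y * P * D) * (Y * P * D) = D * D"
    by (simp only: YP(3) left_mult_one_mat[OF mat_diag_dim])
  have "transpose_mat (Y * P * D) * (X * Q) = D * (transpose_mat (Y * P) * (X * Q))"
    unfolding ED using YP XQ by (intro assoc_mult_mat[of _ k k _ n _ k]) auto
  then have EX: "transpose_mat (Y * P * D) * (X * Q) = 1\<^sub>m k" by (simp only: gram cos_diag_inverse)
  have "transpose_mat N * N = (transpose_mat (Y * P * D) - transpose_mat (X * Q)) * N"
    unfolding secant_mat_def using transpose_minus[OF scaled_carrier XQ(1)] by simp
  also have "\<dots> = transpose_mat (Y * P * D) * N - transpose_mat (X * Q) * N"
    by (rule minus_mult_distrib_mat[OF Et XQ(2) secant_carrier])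
  also have "transpose_mat (Y * P * D) * N = D * D - 1\<^sub>m k"
    unfolding secant_mat_def using mult_minus_distrib_mat[OF Et scaled_carrier XQ(1)] EE EX by simp
  also have "D * D - 1\<^sub>m k - transpose_mat (X * Q) * N = mat_diag k (\<lambda>i. (tan (th i))\<^sup>2)"
  proof -
    have "1 / cos (th i) * (1 / cos (th i)) - 1 = (tan (th i))\<^sup>2" if "i < k" for i
      using cos_pos[OF that] tan_sec[of "th i"] by (simp add: power2_eq_square inverse_eq_divide)
    then show ?thesis unfolding mat_diag_diag
      by (auto simp: secant_tangent mat_diag_def intro!: eq_matI)
  qed
  finally show ?thesis .
qed

text \<open>Since \<open>X\<^sup>T Y = Q C P\<^sup>T\<close>, the inverse is \<open>P C\<^sup>-\<^sup>1 Q\<^sup>T\<close>, and \<open>Z = Y (X\<^sup>T Y)\<^sup>-\<^sup>1\<close> satisfies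
  \<open>X\<^sup>T Z = I\<close>: the projection merely subtracts \<open>X\<close>.\<close>

lemma Log_argument:
  "(1\<^sub>m n - X * transpose_mat X) * Y * the (mat_inverse (transpose_mat X * Y)) = N * transpose_mat Q"
proof -
  define G where "G = transpose_mat X * Y"
  define B where "B = P * D * transpose_mat Q"
  have G: "G \<in> carrier_mat k k" using Xc Yc by (simp add: G_def)
  have PD: "P * D \<in> carrier_mat k k" using Pc by (meson mat_diag_dim mult_carrier_mat)
  have B: "B \<in> carrier_mat k k" using PD Qc by (simp add: B_def)
  have "transpose_mat Q * G * P = C"
    using gram_mult_right[of X n k Y Q k P] Xc Yc Pc Qc gram_flipped by (simp add: G_def)
  then have "Q * C = Q * (transpose_mat Q * (G * P))"
    using Qc G Pc by (simp add: assoc_mult_mat[of _ k k _ k _ k])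
  also have "\<dots> = Q * transpose_mat Q * (G * P)"
    using Qc G Pc by (intro assoc_mult_mat[symmetric]) auto
  also have "\<dots> = G * P" using stiefel_square[OF Q] G Pc by simp
  finally have GP: "G * P = Q * C" by simp
  have "G * B = G * (P * D) * transpose_mat Q"
    unfolding B_def using G PD Qc by (intro assoc_mult_mat[symmetric, of _ k k _ k _ k]) auto
  also have "G * (P * D) = G * P * D" using G Pc by (intro assoc_mult_mat[symmetric, of _ k k _ k _ k]) auto
  also have "\<dots> = Q * (C * D)" unfolding GP using Qc by (intro assoc_mult_mat[of _ k k _ k _ k]) auto
  also have "\<dots> = Q" using Qc by (simp only: cos_diag_inverse right_mult_one_mat)
  finally have GB: "G * B = 1\<^sub>m k" using stiefel_square[OF Q] by simp
  define Z where "Z = Y * B"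
  have Z: "Z \<in> carrier_mat n k" using Yc B by (simp add: Z_def)
  have XXt: "X * transpose_mat X \<in> carrier_mat n n" using Xc by simp
  have EQ: "Y * P * D * transpose_mat Q = Z"
  proof -
    have "Y * P * D * transpose_mat Q = Y * (P * D) * transpose_mat Q"
      using Yc Pc by (simp add: assoc_mult_mat[of _ n k _ k _ k])
    also have "\<dots> = Z"
      unfolding Z_def B_def using Yc PD Qc by (intro assoc_mult_mat) auto
    finally show ?thesis .
  qed
  have "(1\<^sub>m n - X * transpose_mat X) * Y * B = (1\<^sub>m n - X * transpose_mat X) * Z"
    unfolding Z_def using XXt Yc B by (intro assoc_mult_mat minus_carrier_mat) auto
  also have "\<dots> = Z - X * transpose_mat X * Z"
    using minus_mult_distrib_mat[OF one_carrier_mat XXt Z] Z by simp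
  also have "X * transpose_mat X * Z = X * (transpose_mat X * Z)"
    using Xc Z by (intro assoc_mult_mat) auto
  also have "transpose_mat X * Z = G * B"
    unfolding Z_def G_def using Xc Yc B by (intro assoc_mult_mat[symmetric]) auto
  also have "Z - X * (G * B) = N * transpose_mat Q"
    unfolding secant_mat_def
    using minus_mult_distrib_mat[OF scaled_carrier XQ(1) Qc(2)] EQ GB Xc
      mult_stiefel_cancel(1)[OF Q Xc(1)] by simp
  finally show ?thesis
    using the_mat_inverse_eqI[OF G B GB] by (simp add: G_def)
qed

text \<open>The factors \<open>\<theta> / tan \<theta>\<close> are the quotients \<open>arctan t / t\<close> at the singular values \<open>t = tan \<theta>\<close>,
  completed by the limit \<open>1\<close> at \<open>0\<close>.\<close>

lemma riem_Log_eq: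
  "riem_Log n k X Y = N * mat_diag k (\<lambda>i. x_over_tan (th i)) * transpose_mat Q"
proof -
  have tan0: "0 \<le> tan (th i)" if "i < k" for i
    using th[OF that] by (intro tan_pos_pi2_le) auto
  have phi: "x_over_tan (th i) * tan (th i) = arctan (tan (th i))" if "i < k" for i
    using th[OF that] tan_gt_zero[of "th i"] by (cases "th i = 0") (auto simp: x_over_tan_def arctan_tan)
  have unique: "L = N * mat_diag k (\<lambda>i. x_over_tan (th i)) * transpose_mat Q"
    if "\<exists>r U s V. compact_svd n k (N * transpose_mat Q) r U s V \<and>
        L = U * mat_diag r (\<lambda>i. arctan (s i)) * transpose_mat V" for L
    using that compact_svd_fun_unique[OF _ secant_carrier Q secant_gram tan0 phi] by blast
  moreover have "\<exists>L r U s V. compact_svd n k (N * transpose_mat Q) r U s V \<and>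
        L = U * mat_diag r (\<lambda>i. arctan (s i)) * transpose_mat V"
    using compact_svd_exists[OF secant_carrier Q secant_gram tan0] by blast
  ultimately show ?thesis
    unfolding riem_Log_def Log_argument by (rule someI2_ex[rotated])
qed

end

section \<open>Comparing a subspace with the leading eigenspace\<close>

lemma span_orthogonal:
  assumes S: "S \<subseteq> carrier_vec n" and w: "w \<in> vec_span n S"
    and u: "u \<in> carrier_vec n" "\<And>s. s \<in> S \<Longrightarrow> u \<bullet> s = 0"
  shows "u \<bullet> w = 0"
proof -
  interpret vec_space "TYPE(real)" n .
  obtain a B where B: "finite B" "B \<subseteq> S" and w: "w = lincomb a B"
    using w by (auto simp: span_def)
  have BS: "B \<subseteq> carrier_vec n" using B S by blast
  have "u \<bullet> w = (\<Sum>i<n. \<Sum>s\<in>B. a s * (u $ i * s $ i))"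
    unfolding w scalar_prod_def lincomb_dim[OF B(1) BS] atLeast0LessThan
    by (intro sum.cong refl) (simp add: lincomb_index[OF _ BS] sum_distrib_left mult.left_commute)
  also have "\<dots> = (\<Sum>s\<in>B. a s * (\<Sum>i<n. u $ i * s $ i))"
    by (subst sum.swap) (simp add: sum_distrib_left)
  also have "\<dots> = 0"
  proof (intro sum.neutral ballI)
    fix s assume "s \<in> B"
    then have "u \<bullet> s = 0" "s \<in> carrier_vec n" using B S u by auto
    then show "a s * (\<Sum>i<n. u $ i * s $ i) = 0"
      by (simp add: scalar_prod_def atLeast0LessThan)
  qed
  finally show ?thesis .
qed

lemma mat_vec_adjoint:
  fixes M :: "'a::comm_semiring_0 mat"
  assumes "M \<in> carrier_mat n k" "x \<in> carrier_vec k" "y \<in> carrier_vec n"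
  shows "(M *\<^sub>v x) \<bullet> y = x \<bullet> (transpose_mat M *\<^sub>v y)"
  using transpose_vec_mult_scalar[OF assms] assms
  by (simp add: comm_scalar_prod[of "M *\<^sub>v x" n] comm_scalar_prod[of x k])

lemma eigenbasis_parseval:
  assumes e: "ordered_eigenbasis n A lam v" and x: "x \<in> carrier_vec n" and y: "y \<in> carrier_vec n"
  shows "x \<bullet> y = (\<Sum>m<n. (v m \<bullet> x) * (v m \<bullet> y))"
proof -
  let ?W = "mat n n (\<lambda>(i, j). v j $ i)"
  have vc: "v i \<in> carrier_vec n" if "i < n" for i
    using e that by (auto simp: ordered_eigenbasis_def)
  have on: "v i \<bullet> v j = (if i = j then 1 else 0)" if "i < n" "j < n" for i j
    using e that unfolding ordered_eigenbasis_def by blast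
  have colW: "col ?W i = v i" if "i < n" for i
    using vc[OF that] that by (auto intro!: eq_vecI)
  have W: "?W \<in> stiefel n n"
    by (auto simp: stiefel_def colW on simp del: col_mat intro!: eq_matI)
  have "x \<bullet> y = (?W * transpose_mat ?W *\<^sub>v x) \<bullet> y"
    using x by (simp add: stiefel_square[OF W])
  also have "\<dots> = (?W *\<^sub>v (transpose_mat ?W *\<^sub>v x)) \<bullet> y"
    using x by (simp add: assoc_mult_mat_vec[of _ n n _ n])
  also have "\<dots> = (transpose_mat ?W *\<^sub>v x) \<bullet> (transpose_mat ?W *\<^sub>v y)"
    by (rule mat_vec_adjoint[OF stiefelD(1)[OF W] mult_mat_vec_carrier[OF stiefelD(2)[OF W] x] y])
  also have "\<dots> = (\<Sum>m<n. (v m \<bullet> x) * (v m \<bullet> y))"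
    by (simp add: scalar_prod_def[of "transpose_mat ?W *\<^sub>v x"] atLeast0LessThan colW
        del: col_mat)
  finally show ?thesis .
qed

lemma eigenbasis_bilinear:
  assumes A: "A \<in> carrier_mat n n" "transpose_mat A = A" and e: "ordered_eigenbasis n A lam v"
    and x: "x \<in> carrier_vec n" and y: "y \<in> carrier_vec n"
  shows "(A *\<^sub>v x) \<bullet> y = (\<Sum>m<n. lam m * (v m \<bullet> x) * (v m \<bullet> y))"
proof -
  have "v m \<bullet> (A *\<^sub>v x) = lam m * (v m \<bullet> x)" if "m < n" for m
  proof -
    have v: "v m \<in> carrier_vec n" "A *\<^sub>v v m = lam m \<cdot>\<^sub>v v m"
      using e that by (auto simp: ordered_eigenbasis_def)
    have "v m \<bullet> (A *\<^sub>v x) = (A *\<^sub>v v m) \<bullet> x"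
      using transpose_vec_mult_scalar[OF A(1) x v(1)] A x v(1)
      by (simp add: comm_scalar_prod[of _ n])
    then show ?thesis using v x by simp
  qed
  then show ?thesis
    using A x y by (simp add: eigenbasis_parseval[OF e])
qed

text \<open>Here \<open>y\<close> is any orthonormal basis of the span of the first \<open>k\<close> eigenvectors. Membership
  in that span is expressed by the vanishing of the later eigencoordinates.\<close>

context
  fixes n k :: nat and A :: "real mat" and lam :: "nat \<Rightarrow> real" and v y :: "nat \<Rightarrow> real vec"
  assumes k: "1 \<le> k" "k \<le> n" and A: "A \<in> carrier_mat n n" "transpose_mat A = A"
    and e: "ordered_eigenbasis n A lam v"
    and y: "\<And>i. i < k \<Longrightarrow> y i \<in> carrier_vec n"
    and y_orthonormal: "\<And>i j. i < k \<Longrightarrow> j < k \<Longrightarrow> y i \<bullet> y j = (if i = j then 1 else 0)"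
    and y_leading: "\<And>i m. i < k \<Longrightarrow> k \<le> m \<Longrightarrow> m < n \<Longrightarrow> v m \<bullet> y i = 0"
begin

private lemma sum_split: "(\<Sum>m<n. f m) = (\<Sum>m<k. f m) + (\<Sum>m=k..<n. f m :: real)"
  using k by (simp add: lessThan_atLeast0 sum.atLeastLessThan_concat)

lemma leading_parseval:
  assumes "i < k" "z \<in> carrier_vec n"
  shows "z \<bullet> y i = (\<Sum>m<k. (v m \<bullet> z) * (v m \<bullet> y i))"
  using assms by (simp add: eigenbasis_parseval[OF e] y sum_split y_leading)

lemma leading_bilinear:
  assumes "i < k" "z \<in> carrier_vec n"
  shows "(A *\<^sub>v z) \<bullet> y i = (\<Sum>m<k. lam m * (v m \<bullet> z) * (v m \<bullet> y i))"
  using assms by (simp add: eigenbasis_bilinear[OF A e] y sum_split y_leading)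

text \<open>The coordinates of the \<open>y\<^sub>i\<close> form a square matrix with orthonormal columns, so its rows are
  orthonormal too.\<close>

lemma leading_rows_orthonormal:
  assumes m: "m < k" "m' < k"
  shows "(\<Sum>i<k. (v m \<bullet> y i) * (v m' \<bullet> y i)) = (if m = m' then 1 else 0)"
proof -
  let ?R = "mat k k (\<lambda>(m, i). v m \<bullet> y i)"
  have "(\<Sum>m<k. (v m \<bullet> y i) * (v m \<bullet> y j)) = (if i = j then 1 else 0)" if "i < k" "j < k" for i j
    using that y_orthonormal[OF that] by (simp add: leading_parseval y)
  then have "?R \<in> stiefel k k"
    by (auto simp: stiefel_def scalar_prod_def atLeast0LessThan intro!: eq_matI)
  from arg_cong[OF stiefel_square[OF this], of "\<lambda>M. M $$ (m, m')"] m
  show ?thesis by (simp add: scalar_prod_def atLeast0LessThan)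
qed

lemma leading_trace: "(\<Sum>i<k. (A *\<^sub>v y i) \<bullet> y i) = (\<Sum>m<k. lam m)"
proof -
  have "(\<Sum>i<k. (A *\<^sub>v y i) \<bullet> y i) = (\<Sum>i<k. \<Sum>m<k. lam m * ((v m \<bullet> y i) * (v m \<bullet> y i)))"
    by (intro sum.cong refl) (simp add: leading_bilinear y mult.assoc)
  also have "\<dots> = (\<Sum>m<k. lam m * (\<Sum>i<k. (v m \<bullet> y i) * (v m \<bullet> y i)))"
    by (subst sum.swap) (simp add: sum_distrib_left)
  finally show ?thesis by (simp add: leading_rows_orthonormal)
qed

text \<open>Consider now a vector \<open>x\<close> whose projection onto the span of the \<open>y\<^sub>j\<close> is \<open>c y\<^sub>i\<close>.\<close>

context
  fixes i :: nat and x :: "real vec" and c :: real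
  assumes i: "i < k" and x: "x \<in> carrier_vec n"
    and proj: "\<And>j. j < k \<Longrightarrow> y j \<bullet> x = (if j = i then c else 0)"
begin

lemma leading_coordinates:
  assumes m: "m < k"
  shows "v m \<bullet> x = c * (v m \<bullet> y i)"
proof -
  have "v m \<bullet> x = (\<Sum>m'<k. (if m = m' then 1 else 0) * (v m' \<bullet> x))"
    using m by (simp add: if_distrib[of "\<lambda>a. a * _"] cong: if_cong)
  also have "\<dots> = (\<Sum>m'<k. (\<Sum>j<k. (v m \<bullet> y j) * (v m' \<bullet> y j)) * (v m' \<bullet> x))"
    using m by (intro sum.cong refl) (simp add: leading_rows_orthonormal)
  also have "\<dots> = (\<Sum>j<k. (v m \<bullet> y j) * (\<Sum>m'<k. (v m' \<bullet> x) * (v m' \<bullet> y j)))"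
    unfolding sum_distrib_left sum_distrib_right by (subst sum.swap) (simp add: mult_ac)
  also have "\<dots> = (\<Sum>j<k. (v m \<bullet> y j) * (y j \<bullet> x))"
    by (intro sum.cong refl) (simp add: leading_parseval comm_scalar_prod[OF y x] x)
  also have "\<dots> = c * (v m \<bullet> y i)"
    using i by (simp add: proj if_distrib[of "(*) _"] cong: if_cong)
  finally show ?thesis .
qed

text \<open>The part of \<open>x\<close> orthogonal to the leading eigenspace contributes nothing, because that space
  is invariant under \<open>A\<close>.\<close>

lemma rayleigh_mixed: "(A *\<^sub>v x) \<bullet> y i = c * ((A *\<^sub>v y i) \<bullet> y i)"
  using i by (simp add: leading_bilinear x y leading_coordinates sum_distrib_left mult_ac)

text \<open>A unit vector \<open>x\<close> replaces a fraction \<open>1 - c\<^sup>2\<close> of the mass of \<open>y\<^sub>i\<close>, where every eigenvalue is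
  at least \<open>\<lambda>\<^sub>k\<close>, by the same mass where every eigenvalue is at most \<open>\<lambda>\<^sub>k\<close>.\<close>

lemma rayleigh_le:
  assumes unit: "x \<bullet> x = 1"
  shows "(A *\<^sub>v x) \<bullet> x \<le> (A *\<^sub>v y i) \<bullet> y i"
proof -
  let ?\<eta> = "\<lambda>m. v m \<bullet> y i" and ?\<xi> = "\<lambda>m. v m \<bullet> x"
  \<comment> \<open>The threshold \<open>\<lambda>\<^sub>k\<close>, in numbering from \<open>0\<close>.\<close>
  let ?\<mu> = "lam (k - 1)"
  have mono: "lam b \<le> lam a" if "a \<le> b" "b < n" for a b
    using e that unfolding ordered_eigenbasis_def by (meson le_less_trans)
  have \<eta>: "(\<Sum>m<k. (?\<eta> m)\<^sup>2) = 1"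
    using y_orthonormal[OF i i] i by (simp add: leading_parseval y power2_eq_square)
  have \<xi>: "c\<^sup>2 * (\<Sum>m<k. (?\<eta> m)\<^sup>2) + (\<Sum>m=k..<n. (?\<xi> m)\<^sup>2) = 1"
    using unit by (simp add: eigenbasis_parseval[OF e] x sum_split leading_coordinates
        sum_distrib_left power2_eq_square mult_ac)
  have tail: "(\<Sum>m=k..<n. (?\<xi> m)\<^sup>2) = 1 - c\<^sup>2" using \<xi> \<eta> by simp
  then have c: "0 \<le> 1 - c\<^sup>2" by (metis sum_nonneg zero_le_power2)
  have "(A *\<^sub>v x) \<bullet> x = c\<^sup>2 * (\<Sum>m<k. lam m * (?\<eta> m)\<^sup>2) + (\<Sum>m=k..<n. lam m * (?\<xi> m)\<^sup>2)"
    by (simp add: eigenbasis_bilinear[OF A e] x sum_split leading_coordinates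
        sum_distrib_left power2_eq_square mult_ac)
  also have "(\<Sum>m=k..<n. lam m * (?\<xi> m)\<^sup>2) \<le> (\<Sum>m=k..<n. ?\<mu> * (?\<xi> m)\<^sup>2)"
    by (intro sum_mono mult_right_mono mono) auto
  also have "\<dots> = (1 - c\<^sup>2) * (\<Sum>m<k. ?\<mu> * (?\<eta> m)\<^sup>2)"
    by (simp add: tail \<eta> flip: sum_distrib_left)
  also have "\<dots> \<le> (1 - c\<^sup>2) * (\<Sum>m<k. lam m * (?\<eta> m)\<^sup>2)"
    using c k by (intro mult_left_mono sum_mono mult_right_mono mono) auto
  also have "c\<^sup>2 * (\<Sum>m<k. lam m * (?\<eta> m)\<^sup>2) + \<dots> = (\<Sum>m<k. lam m * (?\<eta> m)\<^sup>2)"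
    by (simp add: algebra_simps)
  also have "\<dots> = (A *\<^sub>v y i) \<bullet> y i"
    using i by (simp add: leading_bilinear y power2_eq_square mult.assoc)
  finally show ?thesis by simp
qed

end

end

section \<open>The inequality\<close>

text \<open>The metric moves a right factor from one argument to the other; with it the trace
  expressions for \<open>X\<close> become expressions in principal vectors.\<close>

lemma riem_metric_mult_right:
  assumes G: "G \<in> carrier_mat n k" and H: "H \<in> carrier_mat n l" and Q: "Q \<in> carrier_mat k l"
  shows "riem_metric G (H * transpose_mat Q) = riem_metric (G * Q) H"
proof -
  have "transpose_mat G * (H * transpose_mat Q) = transpose_mat G * H * transpose_mat Q"
    using G H Q by (intro assoc_mult_mat[symmetric]) auto
  moreover have "mat_trace (transpose_mat G * H * transpose_mat Q)
      = mat_trace (transpose_mat Q * (transpose_mat G * H))"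
    using G H Q by (intro mat_trace_mult_comm[of _ k l]) auto
  moreover have "transpose_mat Q * (transpose_mat G * H) = transpose_mat (G * Q) * H"
    using G H Q by (simp add: transpose_mult[of _ n k _ l] assoc_mult_mat[of _ l k _ n _ l])
  ultimately show ?thesis by (simp add: riem_metric_def)
qed

lemma riem_metric_cols:
  assumes "G \<in> carrier_mat n k" "H \<in> carrier_mat n k"
  shows "riem_metric G H = (\<Sum>i<k. col G i \<bullet> col H i)"
  using assms by (simp add: riem_metric_def mat_trace_def)

lemma objective_cols:
  assumes A: "A \<in> carrier_mat n n" and X: "X \<in> stiefel n k" and Q: "Q \<in> stiefel k k"
  shows "objective A X = - (\<Sum>i<k. (A *\<^sub>v col (X * Q) i) \<bullet> col (X * Q) i)"
proof -
  note Xc = stiefelD[OF X] and Qc = stiefelD[OF Q]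
  have XQ: "X * Q \<in> carrier_mat n k" using Xc Qc by simp
  have "transpose_mat X * A * X = transpose_mat X * (A * X)"
    using Xc A by (intro assoc_mult_mat) auto
  then have "objective A X = - riem_metric X (A * X)"
    by (simp add: objective_def riem_metric_def)
  also have "A * X = A * (X * Q) * transpose_mat Q"
    using mult_stiefel_cancel(1)[OF Q Xc(1)] assoc_mult_mat[OF A XQ Qc(2)] by simp
  also have "riem_metric X \<dots> = riem_metric (X * Q) (A * (X * Q))"
    using A Xc Qc by (intro riem_metric_mult_right) auto
  also have "\<dots> = (\<Sum>i<k. col (X * Q) i \<bullet> (A *\<^sub>v col (X * Q) i))"
    using A XQ by (simp add: riem_metric_cols[of _ n k] mult_mat_vec_def)
  also have "\<dots> = (\<Sum>i<k. (A *\<^sub>v col (X * Q) i) \<bullet> col (X * Q) i)"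
    using A XQ by (intro sum.cong refl comm_scalar_prod[of _ n]) auto
  finally show ?thesis .
qed

theorem proposition8:
  fixes n k :: nat
    and A X Y :: "real mat"
    and lam th :: "nat \<Rightarrow> real"
    and v :: "nat \<Rightarrow> real vec"
    and XX V\<alpha> :: "real vec set"
  assumes "1 \<le> k" and "k \<le> n - 1"
    and "positive_semidefinite n A"
    and "ordered_eigenbasis n A lam v"
    and "V\<alpha> = vec_span n (v ` {..<k})"
    and "XX \<in> grassmannian n k"
    and "represents n k X XX"
    and "represents n k Y V\<alpha>"
    and "principal_angles k X Y th"
    and "th (k - 1) < pi / 2"
  shows "2 * x_over_tan (th (k - 1)) * (objective A X - global_min n k A)
           \<le> riem_metric (riem_grad n A X) (- riem_Log n k X Y)"
proof -
  note e = \<open>ordered_eigenbasis n A lam v\<close>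
  have k: "1 \<le> k" "k \<le> n" using assms(1,2) by auto
  have A: "A \<in> carrier_mat n n" "transpose_mat A = A"
    using assms(3) by (auto simp: positive_semidefinite_def)
  have X: "X \<in> stiefel n k" and Y: "Y \<in> stiefel n k"
    and spanY: "vec_span n (set (cols Y)) = vec_span n (v ` {..<k})"
    using assms(5,7,8) by (auto simp: represents_def)
  have th: "0 \<le> th i" "th i \<le> th (k - 1)" if "i < k" for i
  proof -
    have "i \<le> k - 1" "k - 1 < k" using that by auto
    then show "0 \<le> th i" "th i \<le> th (k - 1)"
      using assms(9) that unfolding principal_angles_def by blast+
  qed
  have th_lt: "0 \<le> th i \<and> th i < pi / 2" if "i < k" for i
    using th[OF that] assms(10) by simp
  obtain P Q where P: "P \<in> stiefel k k" and Q: "Q \<in> stiefel k k"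
    and gram: "transpose_mat (Y * P) * (X * Q) = mat_diag k (\<lambda>i. cos (th i))"
    using principal_vectors[OF X Y assms(9)] .
  define x where "x i = col (X * Q) i" for i
  define y where "y i = col (Y * P) i" for i
  define d where "d i = x_over_tan (th i)" for i
  define N where "N = secant_mat k (X * Q) (Y * P) th"
  note Xc = stiefelD[OF X] and Yc = stiefelD[OF Y] and Pc = stiefelD[OF P] and Qc = stiefelD[OF Q]
  note XQ = stiefelD[OF stiefel_mult_right[OF X Q]] and YP = stiefelD[OF stiefel_mult_right[OF Y P]]
  note frame = X Y P Q th_lt gram
  have N: "N \<in> carrier_mat n k" unfolding N_def by (rule secant_carrier[OF frame])
  have xc: "x i \<in> carrier_vec n" and yc: "y i \<in> carrier_vec n" if "i < k" for i
    using XQ YP that by (auto simp: x_def y_def)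
  have cos: "0 < cos (th i)" if "i < k" for i
    using th_lt[OF that] by (intro cos_gt_zero_pi) auto
  have xx: "x i \<bullet> x i = 1" if "i < k" for i
    using arg_cong[OF XQ(3), of "\<lambda>M. M $$ (i, i)"] that XQ(1)
    by (simp add: x_def col_scalar_prod_mat[of _ n k _ k] del: index_mult_mat(1))
  have yy: "y i \<bullet> y j = (if i = j then 1 else 0)" if "i < k" "j < k" for i j
    using arg_cong[OF YP(3), of "\<lambda>M. M $$ (i, j)"] that YP(1)
    by (simp add: y_def col_scalar_prod_mat[of _ n k _ k] del: index_mult_mat(1))
  have yx: "y j \<bullet> x i = (if j = i then cos (th i) else 0)" if "i < k" "j < k" for i j
    using arg_cong[OF gram, of "\<lambda>M. M $$ (j, i)"] that XQ(1) YP(1)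
    by (simp add: x_def y_def col_scalar_prod_mat[of _ n k _ k] mat_diag_def del: index_mult_mat(1))
  \<comment> \<open>The later eigenvectors are orthogonal to the leading ones, hence to the columns of \<open>Y\<close>,
    hence to their combinations \<open>y i\<close>.\<close>
  have y_leading: "v m \<bullet> y i = 0" if "i < k" "k \<le> m" "m < n" for i m
  proof -
    have vc: "v j \<in> carrier_vec n" if "j < n" for j
      using e that by (auto simp: ordered_eigenbasis_def)
    have v_orth: "v m \<bullet> v j = 0" if "j < k" for j
      using e that \<open>k \<le> m\<close> \<open>m < n\<close> unfolding ordered_eigenbasis_def by auto
    have "v m \<bullet> col Y j = 0" if "j < k" for j
    proof (rule span_orthogonal)
      interpret vec_space "TYPE(real)" n .
      have "set (cols Y) \<subseteq> carrier_vec n" using Yc cols_dim by blast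
      moreover have "col Y j \<in> set (cols Y)" using that Yc by (auto simp: cols_def)
      ultimately show "col Y j \<in> vec_span n (v ` {..<k})"
        using span_mem unfolding spanY[symmetric] by simp
    qed (use vc v_orth k \<open>m < n\<close> in auto)
    then have "transpose_mat Y *\<^sub>v v m = 0\<^sub>v k"
      using Yc vc[OF \<open>m < n\<close>] by (auto intro!: eq_vecI simp: comm_scalar_prod[of _ n "v m"])
    moreover have "y i = Y *\<^sub>v col P i"
      unfolding y_def using Yc Pc that by (intro col_mult2) auto
    moreover have "(Y *\<^sub>v col P i) \<bullet> v m = col P i \<bullet> (transpose_mat Y *\<^sub>v v m)"
      using Yc Pc vc[OF \<open>m < n\<close>] that by (intro mat_vec_adjoint) auto
    ultimately show ?thesis
      using Pc that comm_scalar_prod[OF vc[OF \<open>m < n\<close>] yc[OF that(1)]] by simp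
  qed
  note leading = k A e yc yy y_leading
  define g where "g i = (A *\<^sub>v y i) \<bullet> y i - (A *\<^sub>v x i) \<bullet> x i" for i
  have g_nonneg: "0 \<le> g i" if "i < k" for i
    unfolding g_def using rayleigh_le[OF leading that xc[OF that] yx[OF that] xx[OF that]] by simp
  have gap: "objective A X - global_min n k A = (\<Sum>i<k. g i)"
    unfolding global_min_attained(4)[OF k A(1) e] objective_cols[OF A(1) X Q] g_def sum_subtractf
      x_def[symmetric] by (simp add: leading_trace[OF leading])
  have metric: "riem_metric (riem_grad n A X) (- riem_Log n k X Y) = 2 * (\<Sum>i<k. d i * g i)"
  proof -
    let ?L = "N * mat_diag k d * transpose_mat Q"
    have L: "riem_Log n k X Y = ?L"
      unfolding N_def d_def by (rule riem_Log_eq[OF frame])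
    have ND: "N * mat_diag k d \<in> carrier_mat n k" using N by (meson mat_diag_dim mult_carrier_mat)
    have Lc: "?L \<in> carrier_mat n k" using ND Qc by simp
    \<comment> \<open>The formula for the pairing with the gradient needs a tangent vector at \<open>X\<close> itself, not at
      the rotated representative.\<close>
    have XN: "transpose_mat X * N = 0\<^sub>m k k"
    proof -
      have "transpose_mat (X * Q) * N = transpose_mat Q * (transpose_mat X * N)"
        using Xc Qc N by (simp add: transpose_mult[of _ n k _ k] assoc_mult_mat[of _ k k _ n _ k])
      then have "Q * (transpose_mat Q * (transpose_mat X * N)) = Q * 0\<^sub>m k k"
        using secant_tangent[OF frame] by (simp add: N_def)
      moreover have "Q * (transpose_mat Q * (transpose_mat X * N)) = Q * transpose_mat Q * (transpose_mat X * N)"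
        using Xc Qc N by (intro assoc_mult_mat[symmetric]) auto
      ultimately show ?thesis using stiefel_square[OF Q] Qc Xc N by simp
    qed
    have "transpose_mat X * ?L = transpose_mat X * (N * mat_diag k d) * transpose_mat Q"
      using Xc ND Qc by (intro assoc_mult_mat[symmetric]) auto
    also have "transpose_mat X * (N * mat_diag k d) = transpose_mat X * N * mat_diag k d"
      using Xc N by (intro assoc_mult_mat[symmetric, of _ k n _ k _ k]) auto
    also have "\<dots> = 0\<^sub>m k k" unfolding XN by (rule left_mult_zero_mat[OF mat_diag_dim])
    finally have XL: "transpose_mat X * ?L = 0\<^sub>m k k" using Qc by simp
    have H: "- ?L \<in> tangent_space n k X"
      using XL Lc Xc mult_uminus_right_mat[OF Xc(2) Lc] by (auto simp: tangent_space_def intro!: eq_matI)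
    have AX: "A * X \<in> carrier_mat n k" using A Xc by simp
    have "riem_metric (riem_grad n A X) (- ?L)
        = 2 * (\<Sum>j<k. \<Sum>i<n. (A * X) $$ (i, j) * ?L $$ (i, j))"
      unfolding riem_grad_metric[OF X A(1) H] using A Xc Lc Qc N
      by (simp add: scalar_prod_def atLeast0LessThan sum_negf)
    also have "(\<Sum>j<k. \<Sum>i<n. (A * X) $$ (i, j) * ?L $$ (i, j)) = riem_metric (A * X) ?L"
      using riem_metric_sum[OF AX Lc] by simp
    also have "\<dots> = riem_metric (A * X * Q) (N * mat_diag k d)"
      using AX ND Qc by (intro riem_metric_mult_right) auto
    also have "A * X * Q = A * (X * Q)" using A Xc Qc by (intro assoc_mult_mat) auto
    also have "riem_metric (A * (X * Q)) (N * mat_diag k d)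
        = (\<Sum>i<k. (A *\<^sub>v x i) \<bullet> col (N * mat_diag k d) i)"
      using A XQ ND by (simp add: riem_metric_cols[of _ n k] mult_mat_vec_def x_def)
    also have "\<dots> = (\<Sum>i<k. d i * g i)"
    proof (intro sum.cong refl)
      fix i assume "i \<in> {..<k}"
      then have i: "i < k" by simp
      have Ax: "A *\<^sub>v x i \<in> carrier_vec n" using A xc[OF i] by simp
      have "col (N * mat_diag k d) i = d i \<cdot>\<^sub>v ((1 / cos (th i)) \<cdot>\<^sub>v y i - x i)"
        unfolding N_def x_def y_def by (rule col_secant_mat[OF XQ(1) YP(1) i])
      then have "(A *\<^sub>v x i) \<bullet> col (N * mat_diag k d) i
          = d i * (1 / cos (th i) * ((A *\<^sub>v x i) \<bullet> y i) - (A *\<^sub>v x i) \<bullet> x i)"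
        using Ax xc[OF i] yc[OF i] by (simp add: scalar_prod_minus_distrib[of _ n])
      then show "(A *\<^sub>v x i) \<bullet> col (N * mat_diag k d) i = d i * g i"
        using rayleigh_mixed[OF leading i xc[OF i] yx[OF i]] cos[OF i] by (simp add: g_def)
    qed
    finally show ?thesis by (simp add: L)
  qed
  have "d (k - 1) * (\<Sum>i<k. g i) \<le> (\<Sum>i<k. d i * g i)"
    unfolding sum_distrib_left d_def using th assms(10) g_nonneg
    by (intro sum_mono mult_right_mono x_over_tan_antimono) auto
  then show ?thesis by (simp add: metric gap d_def)
qed

end
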